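(* Let $\Omega$ be a finite set with $|\Omega|\ge2$, let $P=(p(x,y))_{x,y\in\Omega}$ be an irreducible Markov kernel on $\Omega$ reversible with respect to its stationary distribution $\pi$, and let $n\ge2$. Let $(X_1,X_2,\dots)$ be a stationary Markov chain with transition kernel $P$ (so $X_1\sim\pi$), and put $Y_0=N(X_1,\dots,X_n)$ and $Y_1=N(X_2,\dots,X_{n+1})$. Then every function $F:\Omega_{n,+}^{\#}\to\mathbb R$ satisfies $$\operatorname{Var}_{\widetilde\mu_n}(F)\le\frac{1}{2\operatorname{Gap}(\widetilde P_n)}\,\mathbb E\bigl[(F(Y_1)-F(Y_0))^2\bigr],$$ where $\widetilde P_n$ is the resampled sliding-window count kernel of window length $n$ associated with $P$ and $\widetilde\mu_n$ is the law of $Y_0$.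
   Context: Reversibility means $\pi(x)p(x,y)=\pi(y)p(y,x)$ for all $x,y$. Path law: for $u=(u_1,\dots,u_n)\in\Omega^n$, $\mu_n(u)=\pi(u_1)\prod_{i=1}^{n-1}p(u_i,u_{i+1})$. Counts: $N(u)=(N_x(u))_{x\in\Omega}$ with $N_x(u)=\#\{1\le i\le n:u_i=x\}$; $\Omega_n^{\#}=\{\eta\in\mathbb N^{\Omega}:\sum_x\eta_x=n\}$ (with $0\in\mathbb N$). The count law is $\widetilde\mu_n(\eta)=\sum_{u:N(u)=\eta}\mu_n(u)$, and $\Omega_{n,+}^{\#}=\{\eta\in\Omega_n^{\#}:\widetilde\mu_n(\eta)>0\}$. Let $e_x$ denote the unit vector at coordinate $x$ in $\mathbb N^\Omega$. Count kernel on $\Omega_{n,+}^{\#}$: $$\widetilde P_n(\eta,\xi)=\frac1{\widetilde\mu_n(\eta)}\sum_{u\in\Omega^n:\,N(u)=\eta}\mu_n(u)\sum_{z\in\Omega}p(u_n,z)\,\mathbf 1_{\{\eta-e_{u_1}+e_z=\xi\}} .$$ It is reversible with respect to $\widetilde\mu_n$. Spectral gap: for a Markov kernel $K$ on a finite set $S$ reversible with respect to a probability measure $\rho$, $\mathcal E_K(f,f)=\frac12\sum_{x,y\in S}\rho(x)K(x,y)(f(y)-f(x))^2$, $\operatorname{Var}_\rho(f)$ is the variance of $f$ under $\rho$, and $\operatorname{Gap}(K)=\inf\{\mathcal E_K(f,f)/\operatorname{Var}_\rho(f): f:S\to\mathbb R,\ \operatorname{Var}_\rho(f)>0\}$ (infimum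 in $[0,\infty]$, with $\inf\emptyset=+\infty$ and $1/\infty=0$, relevant only if $\Omega_{n,+}^{\#}$ is a single point). *)

theory Defs
  imports "HOL-Probability.Probability"
begin

definition markov_kernel :: "('a::finite \<Rightarrow> 'a \<Rightarrow> real) \<Rightarrow> bool" where
  "markov_kernel p \<longleftrightarrow> (\<forall>x y. 0 \<le> p x y) \<and> (\<forall>x. (\<Sum>y\<in>UNIV. p x y) = 1)"

primrec kernel_power :: "('a::finite \<Rightarrow> 'a \<Rightarrow> real) \<Rightarrow> nat \<Rightarrow> 'a \<Rightarrow> 'a \<Rightarrow> real" where
  "kernel_power p 0 x y = (if x = y then 1 else 0)"
| "kernel_power p (Suc k) x y = (\<Sum>z\<in>UNIV. kernel_power p k x z * p z y)"

definition irreducible_kernel :: "('a::finite \<Rightarrow> 'a \<Rightarrow> real) \<Rightarrow> bool" where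
  "irreducible_kernel p \<longleftrightarrow> (\<forall>x y. \<exists>k. 0 < kernel_power p k x y)"

definition stationary_distribution ::
    "('a::finite \<Rightarrow> 'a \<Rightarrow> real) \<Rightarrow> ('a \<Rightarrow> real) \<Rightarrow> bool" where
  "stationary_distribution p \<pi> \<longleftrightarrow>
     (\<forall>x. 0 \<le> \<pi> x) \<and> (\<Sum>x\<in>UNIV. \<pi> x) = 1 \<and>
     (\<forall>y. (\<Sum>x\<in>UNIV. \<pi> x * p x y) = \<pi> y)"

definition reversible_kernel ::
    "('a::finite \<Rightarrow> 'a \<Rightarrow> real) \<Rightarrow> ('a \<Rightarrow> real) \<Rightarrow> bool" where
  "reversible_kernel p \<pi> \<longleftrightarrow> (\<forall>x y. \<pi> x * p x y = \<pi> y * p y x)"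

text \<open>
  The chain is indexed by the positive integers; \<open>X 0\<close> is unconstrained.
\<close>

definition stationary_markov_chain ::
    "'w measure \<Rightarrow> ('a::finite \<Rightarrow> real) \<Rightarrow> ('a \<Rightarrow> 'a \<Rightarrow> real) \<Rightarrow> (nat \<Rightarrow> 'w \<Rightarrow> 'a) \<Rightarrow> bool" where
  "stationary_markov_chain M \<pi> p X \<longleftrightarrow>
     prob_space M \<and>
     (\<forall>i\<ge>1. X i \<in> M \<rightarrow>\<^sub>M count_space UNIV) \<and>
     stationary_distribution p \<pi> \<and>
     (\<forall>x. \<P>(\<omega> in M. X 1 \<omega> = x) = \<pi> x) \<and>
     (\<forall>k\<ge>1. \<forall>h. \<forall>y.
        0 < \<P>(\<omega> in M. \<forall>i\<in>{1..k}. X i \<omega> = h i) \<longrightarrow>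
        \<P>(\<omega> in M. X (k + 1) \<omega> = y \<bar> \<forall>i\<in>{1..k}. X i \<omega> = h i) = p (h k) y)"

text \<open>
  A word \<open>(u\<^sub>1, \<dots>, u\<^sub>n)\<close> is a list of length \<open>n\<close>, so \<open>u\<^sub>1\<close> is \<open>hd u\<close> and \<open>u\<^sub>n\<close> is \<open>last u\<close>.
  Its count vector \<open>N(u)\<close> is the function \<open>count_list u\<close>.
\<close>

definition path_law :: "('a::finite \<Rightarrow> real) \<Rightarrow> ('a \<Rightarrow> 'a \<Rightarrow> real) \<Rightarrow> 'a list \<Rightarrow> real" where
  "path_law \<pi> p u = \<pi> (hd u) * (\<Prod>i<length u - 1. p (u ! i) (u ! Suc i))"

definition count_vectors :: "nat \<Rightarrow> ('a::finite \<Rightarrow> nat) set" where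
  "count_vectors n = {\<eta>. (\<Sum>x\<in>UNIV. \<eta> x) = n}"

definition count_law ::
    "('a::finite \<Rightarrow> real) \<Rightarrow> ('a \<Rightarrow> 'a \<Rightarrow> real) \<Rightarrow> nat \<Rightarrow> ('a \<Rightarrow> nat) \<Rightarrow> real" where
  "count_law \<pi> p n \<eta> = (\<Sum>u | length u = n \<and> count_list u = \<eta>. path_law \<pi> p u)"

definition count_support ::
    "('a::finite \<Rightarrow> real) \<Rightarrow> ('a \<Rightarrow> 'a \<Rightarrow> real) \<Rightarrow> nat \<Rightarrow> ('a \<Rightarrow> nat) set" where
  "count_support \<pi> p n = {\<eta> \<in> count_vectors n. 0 < count_law \<pi> p n \<eta>}"

definition unit_vector :: "'a \<Rightarrow> 'a \<Rightarrow> nat" where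
  "unit_vector x = (\<lambda>y. if y = x then 1 else 0)"

text \<open>
  The natural-number subtraction below never truncates: \<open>\<eta>\<close> is the count vector of the nonempty
  word \<open>u\<close> (for \<open>n \<ge> 1\<close>), so it is at least \<open>1\<close> at \<open>hd u\<close>.
\<close>

definition count_kernel ::
    "('a::finite \<Rightarrow> real) \<Rightarrow> ('a \<Rightarrow> 'a \<Rightarrow> real) \<Rightarrow> nat \<Rightarrow> ('a \<Rightarrow> nat) \<Rightarrow> ('a \<Rightarrow> nat) \<Rightarrow> real" where
  "count_kernel \<pi> p n \<eta> \<xi> =
     1 / count_law \<pi> p n \<eta> *
     (\<Sum>u | length u = n \<and> count_list u = \<eta>.
        path_law \<pi> p u *
        (\<Sum>z\<in>UNIV. p (last u) z *
           (if (\<lambda>x. \<eta> x - unit_vector (hd u) x + unit_vector z x) = \<xi> then 1 else 0)))"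

text \<open>
  Below \<open>S\<close> is a finite set and \<open>\<rho>\<close> the mass function of a probability measure on it. Functions on
  \<open>S\<close> are represented by functions on the whole type; values outside \<open>S\<close> are never used.
\<close>

definition mean_on :: "'s set \<Rightarrow> ('s \<Rightarrow> real) \<Rightarrow> ('s \<Rightarrow> real) \<Rightarrow> real" where
  "mean_on S \<rho> f = (\<Sum>x\<in>S. \<rho> x * f x)"

definition variance_on :: "'s set \<Rightarrow> ('s \<Rightarrow> real) \<Rightarrow> ('s \<Rightarrow> real) \<Rightarrow> real" where
  "variance_on S \<rho> f = (\<Sum>x\<in>S. \<rho> x * (f x - mean_on S \<rho> f)\<^sup>2)"

definition dirichlet_form ::
    "'s set \<Rightarrow> ('s \<Rightarrow> real) \<Rightarrow> ('s \<Rightarrow> 's \<Rightarrow> real) \<Rightarrow> ('s \<Rightarrow> real) \<Rightarrow> real" where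
  "dirichlet_form S \<rho> K f =
     1 / 2 * (\<Sum>x\<in>S. \<Sum>y\<in>S. \<rho> x * K x y * (f y - f x)\<^sup>2)"

text \<open>
  Extended real values make the infimum over the empty set equal to \<open>\<infinity>\<close>, with \<open>1 / \<infinity> = 0\<close>.
\<close>

definition spectral_gap ::
    "'s set \<Rightarrow> ('s \<Rightarrow> real) \<Rightarrow> ('s \<Rightarrow> 's \<Rightarrow> real) \<Rightarrow> ereal" where
  "spectral_gap S \<rho> K =
     (INF f\<in>{f. 0 < variance_on S \<rho> f}. ereal (dirichlet_form S \<rho> K f / variance_on S \<rho> f))"

definition window_count :: "(nat \<Rightarrow> 'w \<Rightarrow> 'a) \<Rightarrow> nat \<Rightarrow> nat \<Rightarrow> 'w \<Rightarrow> 'a \<Rightarrow> nat" where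
  "window_count X n j \<omega> = count_list (map (\<lambda>i. X i \<omega>) [j + 1..<j + n + 1])"

end

(*
  The expectation on the right is at least twice the Dirichlet form of F, since one step of the
  resampled chain replaces the window (X_1, ..., X_n), conditioned on its count vector, by
  (X_2, ..., X_{n+1}); so the claim is the variational definition of the gap. Reading
  1/0 = \<infinity>, a vanishing gap could only hurt if the expectation vanished with Var F > 0. In that case
  F would be invariant under every admissible one-letter shift of the window, and irreducibility
  joins any two admissible words by a longer admissible word, so F would be constant on the support.
*)
theory Submission
  imports Defs
begin

section \<open>Admissible words\<close>

lemma stationary_kernel_power:
  assumes "stationary_distribution p \<pi>"
  shows "(\<Sum>x\<in>UNIV. \<pi> x * kernel_power p k x y) = \<pi> y"
proof (induction k arbitrary: y)
  case 0
  have "(\<Sum>x\<in>UNIV. \<pi> x * kernel_power p 0 x y) = (\<Sum>x\<in>UNIV. if x = y then \<pi> x else 0)"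
    by (intro sum.cong) auto
  then show ?case by simp
next
  case (Suc k)
  have "(\<Sum>x\<in>UNIV. \<pi> x * kernel_power p (Suc k) x y)
      = (\<Sum>x\<in>UNIV. \<Sum>z\<in>UNIV. \<pi> x * kernel_power p k x z * p z y)"
    by (simp add: sum_distrib_left mult.assoc)
  also have "\<dots> = (\<Sum>z\<in>UNIV. (\<Sum>x\<in>UNIV. \<pi> x * kernel_power p k x z) * p z y)"
    by (subst sum.swap) (simp add: sum_distrib_right)
  also have "\<dots> = \<pi> y"
    using assms by (simp add: Suc.IH stationary_distribution_def)
  finally show ?case .
qed

lemma kernel_power_nonneg:
  assumes "markov_kernel p"
  shows "0 \<le> kernel_power p k x y"
  using assms by (induction k arbitrary: y) (auto simp: markov_kernel_def intro!: sum_nonneg)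

text \<open>Total mass one gives some state \<open>x\<close> of positive mass, irreducibility
  carries part of this mass to \<open>y\<close> in \<open>k\<close> steps, and \<open>\<pi>\<close>
  is invariant under the \<open>k\<close>-step kernel.\<close>

lemma stationary_distribution_pos:
  assumes mk: "markov_kernel p" and irr: "irreducible_kernel p"
    and st: "stationary_distribution p \<pi>"
  shows "0 < \<pi> y"
proof -
  have nn: "0 \<le> \<pi> x" for x
    using st by (simp add: stationary_distribution_def)
  have "(\<Sum>x\<in>UNIV. \<pi> x) \<noteq> 0"
    using st by (simp add: stationary_distribution_def)
  then obtain x where "\<pi> x \<noteq> 0"
    by (meson sum.neutral)
  then have x: "0 < \<pi> x"
    using nn[of x] by simp
  obtain k where k: "0 < kernel_power p k x y"
    using irr by (auto simp: irreducible_kernel_def)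
  have "0 < (\<Sum>x\<in>UNIV. \<pi> x * kernel_power p k x y)"
    using x k nn kernel_power_nonneg[OF mk]
    by (intro sum_pos2[of _ x]) auto
  then show ?thesis
    using stationary_kernel_power[OF st] by simp
qed

text \<open>A positive sum of nonnegative terms has a positive term, so the last transition can be
  peeled off. The word contains both endpoints; for \<open>k = 0\<close> it is the single letter
  \<open>[x]\<close>. It later serves to connect two windows.\<close>

lemma kernel_power_pos_imp_path:
  assumes "markov_kernel p" and "0 < kernel_power p k x y"
  obtains c where "c \<noteq> []" "hd c = x" "last c = y" "successively (\<lambda>a b. 0 < p a b) c"
proof -
  have "\<exists>c. c \<noteq> [] \<and> hd c = x \<and> last c = y \<and> successively (\<lambda>a b. 0 < p a b) c"
    using assms(2)
  proof (induction k arbitrary: y)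
    case 0
    then show ?case
      by (intro exI[of _ "[x]"]) (auto split: if_splits)
  next
    case (Suc k)
    have "(\<Sum>z\<in>UNIV. kernel_power p k x z * p z y) \<noteq> 0"
      using Suc.prems by simp
    then obtain z where "kernel_power p k x z * p z y \<noteq> 0"
      by (meson sum.neutral)
    then have z: "0 < kernel_power p k x z" "0 < p z y"
      using assms(1) kernel_power_nonneg[OF assms(1), of k x z]
      by (auto simp: markov_kernel_def order_less_le)
    obtain c where "c \<noteq> []" "hd c = x" "last c = z" "successively (\<lambda>a b. 0 < p a b) c"
      using Suc.IH[OF z(1)] by blast
    then show ?case
      using z(2) by (intro exI[of _ "c @ [y]"]) (auto simp: successively_append_iff)
  qed
  then show ?thesis
    using that by blast
qed

lemma path_law_nonneg:
  assumes "markov_kernel p" and "stationary_distribution p \<pi>"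
  shows "0 \<le> path_law \<pi> p u"
  using assms
  by (auto simp: path_law_def markov_kernel_def stationary_distribution_def
      intro!: mult_nonneg_nonneg prod_nonneg)

text \<open>Since \<open>\<pi>\<close> is positive everywhere, the initial factor never decides
  positivity. Admissibility thus becomes a condition on neighbouring letters, which passes to
  subwords and can be checked at the junctions of a concatenation.\<close>

lemma path_law_pos_iff_successively:
  assumes mk: "markov_kernel p" and irr: "irreducible_kernel p"
    and st: "stationary_distribution p \<pi>"
  shows "0 < path_law \<pi> p u \<longleftrightarrow> successively (\<lambda>a b. 0 < p a b) u"
proof -
  have pos: "0 < \<pi> (hd u)"
    by (rule stationary_distribution_pos[OF assms])
  have "(0 < (\<Prod>i<length u - 1. p (u ! i) (u ! Suc i)))
      \<longleftrightarrow> (\<forall>i<length u - 1. 0 < p (u ! i) (u ! Suc i))" (is "0 < ?P \<longleftrightarrow> _")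
  proof
    assume "0 < ?P"
    then have "\<forall>i<length u - 1. p (u ! i) (u ! Suc i) \<noteq> 0"
      by (metis finite_lessThan lessThan_iff order_less_irrefl prod_zero)
    then show "\<forall>i<length u - 1. 0 < p (u ! i) (u ! Suc i)"
      using mk by (auto simp: markov_kernel_def order_less_le)
  qed (auto intro!: prod_pos)
  then show ?thesis
    using pos by (auto simp: path_law_def zero_less_mult_iff successively_conv_nth)
qed

lemma path_law_snoc:
  assumes "u \<noteq> []"
  shows "path_law \<pi> p (u @ [z]) = path_law \<pi> p u * p (last u) z"
proof -
  obtain m where m: "length u = Suc m"
    using assms by (cases u) auto
  have "(\<Prod>i<m. p ((u @ [z]) ! i) ((u @ [z]) ! Suc i)) = (\<Prod>i<m. p (u ! i) (u ! Suc i))"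
    using m by (intro prod.cong) (auto simp: nth_append)
  then show ?thesis
    using assms m by (simp add: path_law_def last_conv_nth nth_append)
qed

section \<open>The law of the chain\<close>

lemma sets_cylinder:
  assumes "stationary_markov_chain M \<pi> p X"
  shows "{\<omega>\<in>space M. \<forall>i\<in>{1..k}. X i \<omega> = h i} \<in> sets M"
proof -
  have "{\<omega>\<in>space M. X i \<omega> = h i} \<in> sets M" if "i \<in> {1..k}" for i
  proof -
    have "X i \<in> M \<rightarrow>\<^sub>M count_space UNIV"
      using assms that by (simp add: stationary_markov_chain_def)
    from measurable_sets[OF this, of "{h i}"] show ?thesis
      by (simp add: vimage_def Int_def conj_commute)
  qed
  then show ?thesis
    by (intro sets.sets_Collect_finite_All) auto
qed

text \<open>Translates between the two indexings: the chain starts at time 1, list positions start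
  at 0.\<close>

lemma map_upt_eq_iff:
  assumes "length u = k"
  shows "map f [1..<Suc k] = u \<longleftrightarrow> (\<forall>i\<in>{1..k}. f i = u ! (i - 1))"
proof -
  have "(\<forall>i\<in>{1..k}. f i = u ! (i - 1)) \<longleftrightarrow> (\<forall>i<k. f (Suc i) = u ! i)"
  proof safe
    fix i assume "\<forall>i<k. f (Suc i) = u ! i" "i \<in> {1..k}"
    then show "f i = u ! (i - 1)"
      by (cases i) auto
  qed force
  then show ?thesis
    using assms by (auto simp: list_eq_iff_nth_eq simp del: upt_Suc)
qed

text \<open>The chain rule for conditional probabilities, applied to one coordinate after
  another.\<close>

lemma stationary_markov_chain_cylinder:
  assumes chain: "stationary_markov_chain M \<pi> p X"
  shows "measure M {\<omega>\<in>space M. \<forall>i\<in>{1..Suc k}. X i \<omega> = h i}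
    = \<pi> (h 1) * (\<Prod>i\<in>{1..<Suc k}. p (h i) (h (Suc i)))"
proof (induction k)
  case 0
  then show ?case
    using chain by (simp add: stationary_markov_chain_def)
next
  case (Suc k)
  interpret prob_space M
    using chain by (simp add: stationary_markov_chain_def)
  let ?B = "{\<omega>\<in>space M. \<forall>i\<in>{1..Suc k}. X i \<omega> = h i}"
  let ?A = "{\<omega>\<in>space M. \<forall>i\<in>{1..Suc (Suc k)}. X i \<omega> = h i}"
  \<comment> \<open>The newest coordinate is split off so that the event has the shape of the
    numerator in \<open>cond_prob\<close>.\<close>
  have A: "?A = {\<omega>\<in>space M. X (Suc k + 1) \<omega> = h (Suc (Suc k)) \<and> (\<forall>i\<in>{1..Suc k}. X i \<omega> = h i)}"
    by (auto simp: atLeastAtMostSuc_conv)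
  have "prob ?A = prob ?B * p (h (Suc k)) (h (Suc (Suc k)))"
  proof (cases "0 < prob ?B")
    case True
    then have "prob ?A / prob ?B = p (h (Suc k)) (h (Suc (Suc k)))"
      using chain unfolding stationary_markov_chain_def cond_prob_def A by auto
    then show ?thesis
      using True by (simp add: field_simps)
  next
    \<comment> \<open>The Markov property only speaks of conditioning events of positive
      probability. Here the longer cylinder lies in a null one, so both sides vanish.\<close>
    case False
    then have "prob ?B = 0"
      by (simp add: zero_less_measure_iff)
    moreover have "prob ?A \<le> prob ?B"
      by (intro finite_measure_mono sets_cylinder[OF chain]) auto
    ultimately have "prob ?A = 0"
      by (intro order_antisym) simp_all
    then show ?thesis
      using \<open>prob ?B = 0\<close> by simp
  qed
  then show ?case
    using Suc.IH by (simp add: mult.assoc)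
qed

lemma stationary_markov_chain_word_law:
  assumes chain: "stationary_markov_chain M \<pi> p X" and "u \<noteq> []"
  shows "measure M {\<omega>\<in>space M. map (\<lambda>i. X i \<omega>) [1..<Suc (length u)] = u} = path_law \<pi> p u"
proof -
  obtain k where k: "length u = Suc k"
    using assms(2) by (cases u) auto
  have "(\<Prod>i\<in>{1..<Suc k}. p (u ! (i - 1)) (u ! (Suc i - 1)))
      = (\<Prod>i<k. p (u ! i) (u ! Suc i))"
    using prod.shift_bounds_Suc_ivl[of "\<lambda>i. p (u ! (i - 1)) (u ! (Suc i - 1))" 0 k]
    by (simp add: lessThan_atLeast0)
  then show ?thesis
    unfolding map_upt_eq_iff[OF refl]
    using stationary_markov_chain_cylinder[OF chain, of k "\<lambda>i. u ! (i - 1)"] assms(2)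
    by (simp add: path_law_def k hd_conv_nth)
qed

lemma finite_words: "finite {u :: 'a::finite list. length u = n \<and> P u}"
  by (rule finite_subset[OF _ finite_lists_length_eq[of "UNIV :: 'a set" n]]) auto

text \<open>The first \<open>m\<close> letters form a word with finitely many values, so
  \<open>g\<close> of it is a finite combination of indicators and integrates to a sum over
  words.\<close>

lemma stationary_markov_chain_word_expectation:
  fixes g :: "'a::finite list \<Rightarrow> real"
  assumes chain: "stationary_markov_chain M \<pi> p X" and "1 \<le> m"
  shows "(\<integral>\<omega>. g (map (\<lambda>i. X i \<omega>) [1..<Suc m]) \<partial>M) = (\<Sum>u | length u = m. path_law \<pi> p u * g u)"
proof -
  interpret prob_space M
    using chain by (simp add: stationary_markov_chain_def)
  let ?W = "\<lambda>\<omega>. map (\<lambda>i. X i \<omega>) [1..<Suc m]"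
  let ?E = "\<lambda>u. {\<omega>\<in>space M. ?W \<omega> = u}"
  have fin: "finite {u :: 'a list. length u = m}"
    using finite_words[of m "\<lambda>_. True"] by simp
  have sets: "?E u \<in> sets M" for u
  proof (cases "length u = m")
    case True
    then show ?thesis
      using sets_cylinder[OF chain, of m "\<lambda>i. u ! (i - 1)"]
      by (simp only: map_upt_eq_iff)
  next
    case False
    then have "?E u = {}" by (auto simp del: upt_Suc)
    then show ?thesis by (simp only: sets.empty_sets)
  qed
  have "(\<integral>\<omega>. g (?W \<omega>) \<partial>M) = (\<integral>\<omega>. (\<Sum>u | length u = m. g u * indicator (?E u) \<omega>) \<partial>M)"
  proof (rule Bochner_Integration.integral_cong[OF refl])
    fix \<omega> assume \<omega>: "\<omega> \<in> space M"
    have "(\<Sum>u | length u = m. g u * indicator (?E u) \<omega>)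
        = (\<Sum>u | length u = m. if u = ?W \<omega> then g u else 0)"
      using \<omega> by (intro sum.cong) (auto simp: indicator_def simp del: upt_Suc)
    also have "\<dots> = g (?W \<omega>)"
      using fin by (simp del: upt_Suc)
    finally show "g (?W \<omega>) = (\<Sum>u | length u = m. g u * indicator (?E u) \<omega>)" ..
  qed
  also have "\<dots> = (\<Sum>u | length u = m. g u * prob (?E u))"
    using sets by (subst Bochner_Integration.integral_sum)
      (auto simp del: upt_Suc simp: emeasure_eq_measure intro!: integrable_mult_right integrable_real_indicator)
  also have "\<dots> = (\<Sum>u | length u = m. path_law \<pi> p u * g u)"
  proof (intro sum.cong refl)
    fix u :: "'a list" assume "u \<in> {u. length u = m}"
    then have u: "length u = m" "u \<noteq> []"
      using \<open>1 \<le> m\<close> by auto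
    show "g u * prob (?E u) = path_law \<pi> p u * g u"
      using stationary_markov_chain_word_law[OF chain u(2)] u(1) by (simp del: upt_Suc)
  qed
  finally show ?thesis .
qed

section \<open>One step of the sliding window\<close>

text \<open>The expected squared increment of \<open>F\<close> written without a probability space:
  \<open>w\<close> runs over the values of the first \<open>n + 1\<close> letters, and
  \<open>butlast w\<close> and \<open>tl w\<close> are the two successive windows.\<close>

definition shift_energy ::
    "('a::finite \<Rightarrow> real) \<Rightarrow> ('a \<Rightarrow> 'a \<Rightarrow> real) \<Rightarrow> nat \<Rightarrow> (('a \<Rightarrow> nat) \<Rightarrow> real) \<Rightarrow> real" where
  "shift_energy \<pi> p n F =
     (\<Sum>w | length w = Suc n. path_law \<pi> p w * (F (count_list (tl w)) - F (count_list (butlast w)))\<^sup>2)"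

lemma expectation_window_count:
  fixes X :: "nat \<Rightarrow> 'w \<Rightarrow> 'a::finite"
  assumes "stationary_markov_chain M \<pi> p X"
  shows "(\<integral>\<omega>. (F (window_count X n 1 \<omega>) - F (window_count X n 0 \<omega>))\<^sup>2 \<partial>M) = shift_energy \<pi> p n F"
proof -
  have 1: "window_count X n 1 \<omega> = count_list (tl (map (\<lambda>i. X i \<omega>) [1..<Suc (Suc n)]))" for \<omega>
    by (simp add: window_count_def map_tl upt_conv_Cons numeral_2_eq_2 del: upt_Suc)
  have 0: "window_count X n 0 \<omega> = count_list (butlast (map (\<lambda>i. X i \<omega>) [1..<Suc (Suc n)]))" for \<omega>
    by (simp add: window_count_def map_butlast[symmetric])
  show ?thesis
    unfolding 0 1 shift_energy_def
    by (rule stationary_markov_chain_word_expectation[OF assms,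
          where g = "\<lambda>w. (F (count_list (tl w)) - F (count_list (butlast w)))\<^sup>2"]) simp
qed

text \<open>The letter \<open>hd u\<close> occurs in \<open>u\<close>, so the subtraction is exact.
  This turns the vector arithmetic in the count kernel into an operation on words.\<close>

lemma count_list_shift:
  assumes "u \<noteq> []"
  shows "(\<lambda>x. count_list u x - unit_vector (hd u) x + unit_vector z x) = count_list (tl u @ [z])"
  using assms by (cases u) (auto simp: unit_vector_def fun_eq_iff)

lemma sum_words_Suc:
  fixes G :: "'a::finite list \<Rightarrow> real"
  shows "(\<Sum>w | length w = Suc n. G w) = (\<Sum>u | length u = n. \<Sum>z\<in>UNIV. G (u @ [z]))"
proof -
  have "(\<Sum>u | length u = n. \<Sum>z\<in>UNIV. G (u @ [z]))
      = (\<Sum>(u, z)\<in>{u. length u = n} \<times> UNIV. G (u @ [z]))"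
    by (rule sum.cartesian_product)
  also have "\<dots> = (\<Sum>w | length w = Suc n. G w)"
    by (rule sum.reindex_bij_witness[where i = "\<lambda>w. (butlast w, last w)" and j = "\<lambda>(u, z). u @ [z]"])
      (auto simp: length_Suc_conv_rev)
  finally show ?thesis ..
qed

lemma finite_count_vectors: "finite (count_vectors n :: ('a::finite \<Rightarrow> nat) set)"
proof (rule finite_subset)
  show "count_vectors n \<subseteq> (\<Pi>\<^sub>E x\<in>(UNIV :: 'a set). {..n})"
    by (auto simp: count_vectors_def PiE_def intro: member_le_sum)
qed (auto intro: finite_PiE)

text \<open>The weight \<open>count_law\<close> cancels the normalisation of the kernel, leaving a
  sum over pairs of a word \<open>u\<close> and a new letter \<open>z\<close>, that is, over words
  \<open>u @ [z]\<close> of length \<open>n + 1\<close>. Restricting to the support can only discard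
  nonnegative terms, whence the inequality.\<close>

lemma dirichlet_form_count_kernel_le:
  fixes p :: "'a::finite \<Rightarrow> 'a \<Rightarrow> real"
  assumes mk: "markov_kernel p" and st: "stationary_distribution p \<pi>" and n: "1 \<le> n"
  shows "2 * dirichlet_form (count_support \<pi> p n) (count_law \<pi> p n) (count_kernel \<pi> p n) F
    \<le> shift_energy \<pi> p n F"
proof -
  let ?S = "count_support \<pi> p n"
  let ?G = "\<lambda>u z. (F (count_list (tl u @ [z])) - F (count_list u))\<^sup>2"
  have fS: "finite ?S"
    by (rule finite_subset[OF _ finite_count_vectors[of n]]) (auto simp: count_support_def)
  have nn: "0 \<le> path_law \<pi> p u * p (last u) z" for u z
    using path_law_nonneg[OF mk st] mk by (simp add: markov_kernel_def)
  have inner: "(\<Sum>\<xi>\<in>?S. count_law \<pi> p n \<eta> * count_kernel \<pi> p n \<eta> \<xi> * (F \<xi> - F \<eta>)\<^sup>2)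
      \<le> (\<Sum>u | length u = n \<and> count_list u = \<eta>. \<Sum>z\<in>UNIV. path_law \<pi> p u * p (last u) z * ?G u z)"
    if \<eta>: "\<eta> \<in> ?S" for \<eta>
  proof -
    let ?W = "{u. length u = n \<and> count_list u = \<eta>}"
    have fW: "finite ?W"
      by (rule finite_words)
    \<comment> \<open>Under the indicator, \<open>F \<xi>\<close> can be replaced by the value at
      the shifted word. Then \<open>\<xi>\<close> survives only in the indicator and can be summed
      out.\<close>
    have "count_law \<pi> p n \<eta> * count_kernel \<pi> p n \<eta> \<xi> * (F \<xi> - F \<eta>)\<^sup>2
        = (\<Sum>u\<in>?W. \<Sum>z\<in>UNIV. path_law \<pi> p u * p (last u) z *
            (if \<xi> = count_list (tl u @ [z]) then ?G u z else 0))" for \<xi>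
    proof -
      \<comment> \<open>Membership of \<open>\<eta>\<close> in the support makes
        \<open>count_law\<close> nonzero, so the division cancels.\<close>
      have "count_law \<pi> p n \<eta> * count_kernel \<pi> p n \<eta> \<xi>
          = (\<Sum>u\<in>?W. path_law \<pi> p u * (\<Sum>z\<in>UNIV. p (last u) z *
           (if (\<lambda>x. \<eta> x - unit_vector (hd u) x + unit_vector z x) = \<xi> then 1 else 0)))"
        using \<eta> by (simp add: count_kernel_def count_support_def)
      also have "\<dots> = (\<Sum>u\<in>?W. \<Sum>z\<in>UNIV. path_law \<pi> p u * p (last u) z *
            (if \<xi> = count_list (tl u @ [z]) then 1 else 0))"
      proof (intro sum.cong refl)
        fix u assume u: "u \<in> ?W"
        then have "u \<noteq> []"
          using n by auto
        then have "(\<lambda>x. \<eta> x - unit_vector (hd u) x + unit_vector z x) = count_list (tl u @ [z])" for z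
          using u count_list_shift[of u z] by simp
        then show "path_law \<pi> p u * (\<Sum>z\<in>UNIV. p (last u) z *
            (if (\<lambda>x. \<eta> x - unit_vector (hd u) x + unit_vector z x) = \<xi> then 1 else 0))
          = (\<Sum>z\<in>UNIV. path_law \<pi> p u * p (last u) z *
            (if \<xi> = count_list (tl u @ [z]) then 1 else 0))"
          unfolding sum_distrib_left by (intro sum.cong refl) auto
      qed
      finally have "count_law \<pi> p n \<eta> * count_kernel \<pi> p n \<eta> \<xi> * (F \<xi> - F \<eta>)\<^sup>2
          = (\<Sum>u\<in>?W. \<Sum>z\<in>UNIV. path_law \<pi> p u * p (last u) z *
            (if \<xi> = count_list (tl u @ [z]) then 1 else 0) * (F \<xi> - F \<eta>)\<^sup>2)"
        by (simp only: sum_distrib_right)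
      then show ?thesis
        by (auto intro!: sum.cong)
    qed
    then have "(\<Sum>\<xi>\<in>?S. count_law \<pi> p n \<eta> * count_kernel \<pi> p n \<eta> \<xi> * (F \<xi> - F \<eta>)\<^sup>2)
        = (\<Sum>\<xi>\<in>?S. \<Sum>u\<in>?W. \<Sum>z\<in>UNIV. path_law \<pi> p u * p (last u) z *
            (if \<xi> = count_list (tl u @ [z]) then ?G u z else 0))"
      by (intro sum.cong refl)
    also have "\<dots> = (\<Sum>u\<in>?W. \<Sum>\<xi>\<in>?S. \<Sum>z\<in>UNIV. path_law \<pi> p u * p (last u) z *
            (if \<xi> = count_list (tl u @ [z]) then ?G u z else 0))"
      by (rule sum.swap)
    also have "\<dots> = (\<Sum>u\<in>?W. \<Sum>z\<in>UNIV. \<Sum>\<xi>\<in>?S. path_law \<pi> p u * p (last u) z *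
            (if \<xi> = count_list (tl u @ [z]) then ?G u z else 0))"
      by (intro sum.cong refl sum.swap)
    also have "\<dots> = (\<Sum>u\<in>?W. \<Sum>z\<in>UNIV. path_law \<pi> p u * p (last u) z *
            (if count_list (tl u @ [z]) \<in> ?S then ?G u z else 0))"
      using fS by (simp add: sum_distrib_left[symmetric] del: count_list_append)
    \<comment> \<open>The terms whose successor lies outside the support are put back; they are
      nonnegative.\<close>
    also have "\<dots> \<le> (\<Sum>u\<in>?W. \<Sum>z\<in>UNIV. path_law \<pi> p u * p (last u) z * ?G u z)"
      using nn by (intro sum_mono mult_left_mono) auto
    finally show ?thesis .
  qed
  have "2 * dirichlet_form ?S (count_law \<pi> p n) (count_kernel \<pi> p n) F
      \<le> (\<Sum>\<eta>\<in>?S. \<Sum>u | length u = n \<and> count_list u = \<eta>.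
            \<Sum>z\<in>UNIV. path_law \<pi> p u * p (last u) z * ?G u z)"
    unfolding dirichlet_form_def using inner by (simp add: sum_mono)
  \<comment> \<open>The words are regrouped: the fibres of \<open>count_list\<close> over the
    support partition the words counted there.\<close>
  also have "\<dots> = (\<Sum>u | length u = n \<and> count_list u \<in> ?S.
            \<Sum>z\<in>UNIV. path_law \<pi> p u * p (last u) z * ?G u z)"
  proof -
    let ?H = "\<lambda>u. \<Sum>z\<in>UNIV. path_law \<pi> p u * p (last u) z * ?G u z"
    let ?U = "{u :: 'a list. length u = n \<and> count_list u \<in> ?S}"
    have "{u. length u = n \<and> count_list u = \<eta>} = {u \<in> ?U. count_list u = \<eta>}" if "\<eta> \<in> ?S" for \<eta>
      using that by auto
    then have "(\<Sum>\<eta>\<in>?S. \<Sum>u | length u = n \<and> count_list u = \<eta>. ?H u)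
        = (\<Sum>\<eta>\<in>?S. \<Sum>u | u \<in> ?U \<and> count_list u = \<eta>. ?H u)"
      by (intro sum.cong[OF refl]) (simp only:)
    also have "\<dots> = (\<Sum>u\<in>?U. ?H u)"
      using fS by (intro sum.group finite_words) auto
    finally show ?thesis .
  qed
  \<comment> \<open>Likewise the words whose own count vector lies outside the support are put
    back.\<close>
  also have "\<dots> \<le> (\<Sum>u | length u = n. \<Sum>z\<in>UNIV. path_law \<pi> p u * p (last u) z * ?G u z)"
    using finite_words[of n "\<lambda>_. True"]
    by (intro sum_mono2 sum_nonneg mult_nonneg_nonneg[OF nn]) auto
  also have "\<dots> = shift_energy \<pi> p n F"
    unfolding shift_energy_def sum_words_Suc
  proof (intro sum.cong refl)
    fix u :: "'a list" and z assume "u \<in> {u. length u = n}"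
    then have "u \<noteq> []"
      using n by auto
    then show "path_law \<pi> p u * p (last u) z * ?G u z = path_law \<pi> p (u @ [z]) *
        (F (count_list (tl (u @ [z]))) - F (count_list (butlast (u @ [z]))))\<^sup>2"
      by (simp add: path_law_snoc)
  qed
  finally show ?thesis .
qed

section \<open>Functions without energy are constant\<close>

text \<open>A window of length \<open>n\<close> slides along \<open>w\<close> one letter at a time;
  each of the \<open>m\<close> moves takes place inside an admissible stretch of
  \<open>n + 1\<close> letters, where the premise applies.\<close>

lemma shift_invariant_along_word:
  assumes "\<And>w. length w = Suc n \<Longrightarrow> successively R w \<Longrightarrow> G (tl w) = G (butlast w)"
    and "length w = n + m" and "successively R w"
  shows "G (drop m w) = G (take n w)"
  using assms(2,3)
proof (induction m arbitrary: w)
  case 0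
  then show ?case by simp
next
  case (Suc m)
  obtain v z where w: "w = v @ [z]" and v: "length v = n + m"
    using Suc.prems(1) by (auto simp: length_Suc_conv_rev)
  have "successively R v"
    using Suc.prems(2) w by (simp add: successively_append_iff)
  then have "G (drop m v) = G (take n v)"
    using Suc.IH v by blast
  \<comment> \<open>\<open>drop m w\<close> consists of the last \<open>n + 1\<close> letters and
    carries the final move. Its \<open>butlast\<close> is \<open>drop m v\<close>, where the
    induction hypothesis leaves the window.\<close>
  moreover have "successively R (drop m w)"
    using Suc.prems(2) append_take_drop_id[of m w] by (metis successively_append_iff)
  then have "G (tl (drop m w)) = G (butlast (drop m w))"
    by (intro assms(1)) (use Suc.prems(1) in auto)
  moreover have "butlast (drop m w) = drop m v"
    using w v by (simp add: butlast_append)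
  moreover have "take n w = take n v"
    using w v by simp
  ultimately show ?case
    by (simp add: drop_Suc tl_drop)
qed

text \<open>Every admissible word of length \<open>n + 1\<close> has positive weight, so zero energy
  forces \<open>F\<close> to agree on its two windows. Sliding along one long admissible word then
  compares any two windows.\<close>

lemma shift_energy_eq_0_imp_constant:
  fixes p :: "'a::finite \<Rightarrow> 'a \<Rightarrow> real"
  assumes mk: "markov_kernel p" and irr: "irreducible_kernel p"
    and st: "stationary_distribution p \<pi>" and n: "1 \<le> n"
    and E: "shift_energy \<pi> p n F = 0"
    and "\<eta> \<in> count_support \<pi> p n" "\<xi> \<in> count_support \<pi> p n"
  shows "F \<eta> = F \<xi>"
proof -
  let ?R = "\<lambda>a b. 0 < p a b"
  have adm: "\<exists>u. length u = n \<and> count_list u = \<eta> \<and> successively ?R u"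
    if "\<eta> \<in> count_support \<pi> p n" for \<eta>
  proof -
    have "count_law \<pi> p n \<eta> \<noteq> 0"
      using that by (simp add: count_support_def)
    then obtain u where "length u = n" "count_list u = \<eta>" "path_law \<pi> p u \<noteq> 0"
      unfolding count_law_def by (force dest: sum.not_neutral_contains_not_neutral)
    then show ?thesis
      using path_law_nonneg[OF mk st, of u] path_law_pos_iff_successively[OF mk irr st, of u] by auto
  qed
  have shift: "F (count_list (tl w)) = F (count_list (butlast w))"
    if "length w = Suc n" "successively ?R w" for w
  proof -
    have "\<forall>w\<in>{w. length w = Suc n}.
        path_law \<pi> p w * (F (count_list (tl w)) - F (count_list (butlast w)))\<^sup>2 = 0"
      using E finite_words[of "Suc n" "\<lambda>_. True"] path_law_nonneg[OF mk st]
      unfolding shift_energy_def by (subst (asm) sum_nonneg_eq_0_iff) auto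
    then show ?thesis
      using that path_law_pos_iff_successively[OF mk irr st, of w] by force
  qed
  obtain u where u: "length u = n" "count_list u = \<eta>" "successively ?R u"
    using adm assms(6) by blast
  obtain v where v: "length v = n" "count_list v = \<xi>" "successively ?R v"
    using adm assms(7) by blast
  have ne: "u \<noteq> []" "v \<noteq> []"
    using u v n by auto
  obtain k where "0 < kernel_power p k (last u) (hd v)"
    using irr by (auto simp: irreducible_kernel_def)
  then obtain c where c: "c \<noteq> []" "hd c = last u" "last c = hd v" "successively ?R c"
    using kernel_power_pos_imp_path[OF mk] by blast
  \<comment> \<open>The path \<open>c\<close> shares its first letter with the end of
    \<open>u\<close> and its last letter with the start of \<open>v\<close>. Keeping each shared
    letter once makes \<open>w\<close> start with \<open>u\<close> and end with \<open>v\<close>,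
    even if \<open>c\<close> is a single letter.\<close>
  define w where "w = butlast u @ c @ tl v"
  have wu: "w = u @ tl c @ tl v"
    using ne c(1,2) unfolding w_def by (cases c; cases u rule: rev_cases) auto
  have wv: "w = butlast u @ butlast c @ v"
    using ne c(1,3) unfolding w_def by (cases v; cases c rule: rev_cases) auto
  have "successively ?R (c @ tl v)"
    using c v ne by (cases v; cases "tl v") (auto simp: successively_append_iff)
  \<comment> \<open>For \<open>n = 1\<close> the word \<open>butlast u\<close> is empty and there is
    no junction, hence the guard.\<close>
  moreover have "successively ?R (butlast u)" "butlast u \<noteq> [] \<Longrightarrow> ?R (last (butlast u)) (last u)"
    using u(3) ne(1) by (cases u rule: rev_cases; simp add: successively_append_iff)+
  ultimately have "successively ?R w"
    using c(1,2) by (auto simp: w_def successively_append_iff)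
  moreover have "length w = n + length (tl c @ tl v)"
    using wu u(1) by simp
  ultimately have "F (count_list (drop (length (tl c @ tl v)) w)) = F (count_list (take n w))"
    using shift_invariant_along_word[of n ?R "\<lambda>w. F (count_list w)" w] shift by blast
  moreover have "drop (length (tl c @ tl v)) w = v"
  proof -
    \<comment> \<open>As \<open>u\<close> and \<open>v\<close> have equal length, as many letters
      precede \<open>v\<close> in \<open>w\<close> as follow \<open>u\<close>.\<close>
    have "length (tl c @ tl v) = length (butlast u @ butlast c)"
      using u(1) v(1) by simp
    moreover have "drop (length (butlast u @ butlast c)) ((butlast u @ butlast c) @ v) = v"
      by simp
    ultimately show ?thesis
      using wv by (simp only: append_assoc)
  qed
  moreover have "take n w = u"
    using wu u(1) by simp
  ultimately show ?thesis
    using u v by simp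
qed

section \<open>Normalisation of the count law, and variance of constants\<close>

lemma sum_count_list: "(\<Sum>x\<in>(UNIV :: 'a::finite set). count_list u x) = length u"
proof (induction u)
  case (Cons a u)
  have "(\<Sum>x\<in>UNIV. count_list (a # u) x)
      = (\<Sum>x\<in>UNIV. count_list u x + (if x = a then 1 else 0))"
    by (intro sum.cong) auto
  then show ?case
    using Cons by (simp add: sum.distrib)
qed simp

text \<open>Summing out the last letter removes one factor, the rows of the kernel having sum one.
  The lengths start at one because \<open>path_law\<close> of the empty word would involve
  \<open>hd []\<close>.\<close>

lemma sum_path_law:
  assumes mk: "markov_kernel p" and st: "stationary_distribution p (\<pi> :: 'a::finite \<Rightarrow> real)"
  shows "(\<Sum>u | length u = Suc n. path_law \<pi> p u) = 1"
proof (induction n)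
  case 0
  have "(\<Sum>u | length u = Suc 0. path_law \<pi> p u) = (\<Sum>z\<in>UNIV. \<pi> z)"
    by (simp add: sum_words_Suc path_law_def)
  then show ?case
    using st by (simp add: stationary_distribution_def)
next
  case (Suc n)
  have "(\<Sum>u | length u = Suc (Suc n). path_law \<pi> p u)
      = (\<Sum>u | length u = Suc n. \<Sum>z\<in>UNIV. path_law \<pi> p (u @ [z]))"
    by (rule sum_words_Suc)
  also have "\<dots> = (\<Sum>u | length u = Suc n. path_law \<pi> p u * (\<Sum>z\<in>UNIV. p (last u) z))"
    unfolding sum_distrib_left by (intro sum.cong refl path_law_snoc) auto
  finally show ?case
    using Suc mk by (simp add: markov_kernel_def)
qed

text \<open>Count vectors outside the support have mass zero, and the fibres of
  \<open>count_list\<close> over all count vectors partition the words of length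
  \<open>n\<close>.\<close>

lemma sum_count_law_support:
  fixes \<pi> :: "'a::finite \<Rightarrow> real"
  assumes mk: "markov_kernel p" and st: "stationary_distribution p \<pi>" and n: "1 \<le> n"
  shows "(\<Sum>\<eta>\<in>count_support \<pi> p n. count_law \<pi> p n \<eta>) = 1"
proof -
  have nn: "0 \<le> count_law \<pi> p n \<eta>" for \<eta>
    unfolding count_law_def by (intro sum_nonneg path_law_nonneg[OF mk st])
  have "(\<Sum>\<eta>\<in>count_support \<pi> p n. count_law \<pi> p n \<eta>) = (\<Sum>\<eta>\<in>count_vectors n. count_law \<pi> p n \<eta>)"
    using nn finite_count_vectors
    by (intro sum.mono_neutral_left) (auto simp: count_support_def order_less_le)
  also have "\<dots> = (\<Sum>u | length u = n. path_law \<pi> p u)"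
    using sum.group[OF _ finite_count_vectors,
        of "{u :: 'a list. length u = n}" count_list n "path_law \<pi> p"]
      finite_words[of n "\<lambda>_. True"]
    by (simp add: count_law_def image_subset_iff) (simp add: count_vectors_def sum_count_list)
  also have "\<dots> = 1"
    using sum_path_law[OF mk st, of "n - 1"] n by simp
  finally show ?thesis .
qed

text \<open>Total mass one makes the mean equal to the common value, so every square
  vanishes.\<close>

lemma variance_on_constant:
  assumes "(\<Sum>x\<in>S. \<rho> x) = 1" and "\<And>x y. x \<in> S \<Longrightarrow> y \<in> S \<Longrightarrow> f x = f y"
  shows "variance_on S \<rho> f = 0"
proof (cases "S = {}")
  case True
  then show ?thesis by (simp add: variance_on_def)
next
  case False
  then obtain a where a: "a \<in> S" by blast
  then have f: "f x = f a" if "x \<in> S" for x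
    using assms(2) that by blast
  have "mean_on S \<rho> f = (\<Sum>x\<in>S. \<rho> x) * f a"
    unfolding mean_on_def sum_distrib_right using f by (intro sum.cong) auto
  then show ?thesis
    using assms(1) f by (simp add: variance_on_def)
qed

section \<open>The variance bound from the variational form of the gap\<close>

theorem mainTheorem4:
  fixes p :: "'a::finite \<Rightarrow> 'a \<Rightarrow> real" and \<pi> :: "'a \<Rightarrow> real" and n :: nat
    and M :: "'w measure" and X :: "nat \<Rightarrow> 'w \<Rightarrow> 'a" and F :: "('a \<Rightarrow> nat) \<Rightarrow> real"
  assumes "CARD('a) \<ge> 2"
    and "markov_kernel p"
    and "irreducible_kernel p"
    and "stationary_distribution p \<pi>"
    and "reversible_kernel p \<pi>"
    and "n \<ge> 2"
    and "stationary_markov_chain M \<pi> p X"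
  shows "ereal (variance_on (count_support \<pi> p n) (count_law \<pi> p n) F)
    \<le> 1 / (2 * spectral_gap (count_support \<pi> p n) (count_law \<pi> p n) (count_kernel \<pi> p n))
        * ereal (\<integral>\<omega>. (F (window_count X n 1 \<omega>) - F (window_count X n 0 \<omega>))\<^sup>2 \<partial>M)"
proof -
  note mk = assms(2) and irr = assms(3) and st = assms(4)
  have n: "1 \<le> n" using assms(6) by simp
  let ?S = "count_support \<pi> p n" and ?\<rho> = "count_law \<pi> p n" and ?K = "count_kernel \<pi> p n"
  let ?E = "shift_energy \<pi> p n F"
  define V where "V = variance_on ?S ?\<rho> F"
  define D where "D = dirichlet_form ?S ?\<rho> ?K F"
  define g where "g = spectral_gap ?S ?\<rho> ?K"
  have D: "2 * D \<le> ?E"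
    unfolding D_def by (rule dirichlet_form_count_kernel_le[OF mk st n])
  have E0: "0 \<le> ?E"
    unfolding shift_energy_def by (intro sum_nonneg mult_nonneg_nonneg path_law_nonneg[OF mk st]) auto
  have nn: "0 \<le> ?\<rho> \<eta>" "0 \<le> ?K \<eta> \<xi>" for \<eta> \<xi>
  proof -
    show \<rho>: "0 \<le> ?\<rho> \<eta>"
      unfolding count_law_def by (intro sum_nonneg path_law_nonneg[OF mk st])
    show "0 \<le> ?K \<eta> \<xi>"
      unfolding count_kernel_def using \<rho> mk path_law_nonneg[OF mk st]
      by (intro mult_nonneg_nonneg sum_nonneg) (auto simp: markov_kernel_def)
  qed
  have "0 \<le> dirichlet_form ?S ?\<rho> ?K f" for f
    unfolding dirichlet_form_def using nn by (intro mult_nonneg_nonneg sum_nonneg) auto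
  then have g0: "0 \<le> g"
    unfolding g_def spectral_gap_def by (intro INF_greatest) auto
  have "ereal V \<le> 1 / (2 * g) * ereal ?E"
  proof (cases "0 < V")
    \<comment> \<open>This covers the infinite gap, which arises when no function has positive
      variance: the right-hand side is then 0, and in general it is nonnegative.\<close>
    case False
    have "0 \<le> 1 / (2 * g) * ereal ?E"
      using g0 E0 by (simp add: zero_le_divide_ereal ereal_0_le_mult)
    moreover have "ereal V \<le> 0"
      using False by simp
    ultimately show ?thesis
      by (rule order_trans[rotated])
  next
    case True
    \<comment> \<open>Needed for a vanishing gap: in \<open>ereal\<close> the product of
      \<open>\<infinity>\<close> and 0 is 0, so the bound would be void of content only if the
      energy is positive.\<close>
    have Epos: "0 < ?E"
    proof (rule ccontr)
      assume "\<not> 0 < ?E"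
      then have "V = 0"
        unfolding V_def
        using E0 shift_energy_eq_0_imp_constant[OF mk irr st n]
        by (intro variance_on_constant sum_count_law_support[OF mk st n]) auto
      then show False using True by simp
    qed
    \<comment> \<open>\<open>F\<close> itself competes in the infimum. The real upper bound also
      shows that the gap is finite.\<close>
    have gle: "g \<le> ereal (D / V)"
      unfolding g_def spectral_gap_def D_def V_def
      using True by (intro INF_lower) (simp add: V_def)
    then obtain r where r: "g = ereal r" "0 \<le> r"
      using g0 by (cases g) auto
    show ?thesis
    proof (cases "r = 0")
      case True
      then have "1 / (2 * g) = \<infinity>"
        using r by (simp add: divide_ereal_def zero_ereal_def[symmetric])
      then have "1 / (2 * g) * ereal ?E = \<infinity>"
        using Epos by (simp only: times_ereal.simps) simp
      then show ?thesis
        by (simp only: ereal_less_eq(1))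
    next
      case False
      \<comment> \<open>With a positive finite gap, \<open>V\<close> is at most
        \<open>D / r\<close>, and \<open>2 * D \<le> ?E\<close> supplies the factor one
        half.\<close>
      then have "r * V \<le> D"
        using gle r \<open>0 < V\<close> by (simp add: field_simps)
      then have "V \<le> 1 / (2 * r) * ?E"
        using False r D by (simp add: field_simps)
      moreover have "1 / (2 * g) = ereal (1 / (2 * r))"
      proof -
        have "2 * g = ereal (2 * r)"
          using r by (metis numeral_eq_ereal times_ereal.simps(1))
        then show ?thesis
          using False by (simp add: one_ereal_def)
      qed
      ultimately show ?thesis
        by simp
    qed
  qed
  then show ?thesis
    unfolding V_def g_def expectation_window_count[OF assms(7)] .
qed

end
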